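(* Let $n$ be a positive integer, let $a$ be a complex parameter, and let $j\in\{0,1,2,\ldots\}$. (i) If $j$ does not lie in the interval $[n+1,2n]$, then $${}_2F_1\left[\begin{array}{c}-n,\ a\\ -2n+j\end{array};2\right]=\frac{2^{2n-j}(n-j)!}{(2n-j)!}\sum_{r=0}^{j}\binom{j}{r}\left(\tfrac12a+\tfrac12-\tfrac12r\right)_n,$$ where, when $j\ge 2n+1$, the ratio of factorials $(n-j)!/(2n-j)!$ is replaced by $(-1)^n\,(j-2n-1)!/(j-n-1)!$. (ii) For every $j\in\{0,1,2,\ldots\}$, $${}_2F_1\left[\begin{array}{c}-n,\ a\\ -2n-j\end{array};2\right]=\frac{2^{2n+j}\,n!}{(2n+j)!}\sum_{r=0}^{j}(-1)^r\binom{j}{r}\left(\tfrac12a+\tfrac12-\tfrac12r\right)_{n+j}.$$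
   Context: For a complex number $x$ and integer $k\ge 0$, $(x)_k=x(x+1)\cdots(x+k-1)$ (with $(x)_0=1$) is the Pochhammer symbol. For a nonnegative integer $N$, the terminating hypergeometric series is the finite sum $${}_2F_1\left[\begin{array}{c} -N,\ b\\ c\end{array};z\right]=\sum_{k=0}^{N}\frac{(-N)_k(b)_k}{(c)_k}\frac{z^k}{k!},$$ defined whenever $(c)_N\ne 0$; in particular, $c$ may be a negative integer with $c\le -N$, in which case the sum is still taken only over $0\le k\le N$. *)

theory Defs
  imports Complex_Main
begin

text \<open>
  The terminating series \<open>2F1[-N, b; c; z]\<close>. The sum is cut off at \<open>k = N\<close> explicitly, so that \<open>c\<close>
  may be a negative integer with \<open>c \<le> -N\<close>. The value is only meaningful if
  \<open>pochhammer c N \<noteq> 0\<close>; otherwise some summands are divisions by zero, which are zero in HOL.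
\<close>

definition hyp2F1_term :: "nat \<Rightarrow> complex \<Rightarrow> complex \<Rightarrow> complex \<Rightarrow> complex" where
  "hyp2F1_term N b c z =
     (\<Sum>k=0..N. pochhammer (- of_nat N) k * pochhammer b k / pochhammer c k * (z ^ k / fact k))"

end

theory Submission
  imports Defs "HOL-Computational_Algebra.Formal_Power_Series"
begin

unbundle fps_syntax

text \<open>
  Multiplied by \<open>(b)\<^sub>n / n!\<close>, the series \<open>2F1[-n, a; 1-b-n; 2]\<close> is the coefficient of \<open>x\<^sup>n\<close> in
  \<open>(1-x)\<^sup>-\<^sup>b (1-2x)\<^sup>-\<^sup>a\<close>. For \<open>b = n+1\<close> this coefficient is \<open>4\<^sup>n ((a+1)/2)\<^sub>n / n!\<close>, by a recurrence that
  expresses that the derivative of \<open>x\<^sup>-\<^sup>n\<^sup>-\<^sup>1 (1-x)\<^sup>-\<^sup>n\<^sup>-\<^sup>1 (1-2x)\<^sup>-\<^sup>a\<^sup>-\<^sup>1\<close> has no residue. For \<open>b = n+1-j\<close>, expand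
  \<open>(1-x)\<^sup>j = 2\<^sup>-\<^sup>j (1 + (1-2x))\<^sup>j\<close> by the binomial theorem; for \<open>b = n+1+j\<close>, read the coefficient as that
  of \<open>x\<^sup>n\<^sup>+\<^sup>j\<close> in the series multiplied by \<open>x\<^sup>j = 2\<^sup>-\<^sup>j (1 - (1-2x))\<^sup>j\<close>.
\<close>

text \<open>The power series \<open>(1 - c x)\<^sup>-\<^sup>a\<close>.\<close>

definition neg_pow_fps :: "'a::field_char_0 \<Rightarrow> 'a \<Rightarrow> 'a fps" where
  "neg_pow_fps c a = Abs_fps (\<lambda>k. pochhammer a k / fact k * c ^ k)"

lemma neg_pow_fps_nth: "neg_pow_fps c a $ k = pochhammer a k / fact k * c ^ k"
  by (simp add: neg_pow_fps_def)

text \<open>Coefficientwise, this is Vandermonde's identity for rising factorials.\<close>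

lemma neg_pow_fps_add: "neg_pow_fps c (a + b) = neg_pow_fps c a * neg_pow_fps c b"
proof (rule fps_ext)
  fix n
  have "(\<Sum>k\<le>n. of_nat (n choose k) * pochhammer a k * pochhammer b (n - k)) / fact n * c ^ n
      = (\<Sum>k\<le>n. (pochhammer a k / fact k * c ^ k) * (pochhammer b (n - k) / fact (n - k) * c ^ (n - k)))"
    unfolding sum_divide_distrib sum_distrib_right
  proof (intro sum.cong refl)
    fix k assume "k \<in> {..n}"
    then have "k \<le> n" by simp
    moreover from this have "c ^ n = c ^ k * c ^ (n - k)"
      by (simp flip: power_add)
    ultimately show "of_nat (n choose k) * pochhammer a k * pochhammer b (n - k) / fact n * c ^ n
      = (pochhammer a k / fact k * c ^ k) * (pochhammer b (n - k) / fact (n - k) * c ^ (n - k))"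
      by (simp add: binomial_fact field_simps)
  qed
  then show "neg_pow_fps c (a + b) $ n = (neg_pow_fps c a * neg_pow_fps c b) $ n"
    by (simp add: neg_pow_fps_nth fps_mult_nth pochhammer_binomial_sum atLeast0AtMost)
qed

lemma neg_pow_fps_minus_one: "neg_pow_fps c (- 1) = 1 - fps_const c * fps_X"
proof (rule fps_ext)
  fix k
  have "pochhammer (- 1 :: 'a) k = 0" if "k \<ge> 2"
    using pochhammer_of_nat_eq_0_lemma[of 1 k, where ?'a = 'a] that by simp
  then show "neg_pow_fps c (- 1) $ k = (1 - fps_const c * fps_X) $ k"
    by (cases k rule: nat.exhaust; cases "k \<ge> 2") (auto simp: neg_pow_fps_nth fps_X_def not_le less_Suc_eq numeral_2_eq_2)
qed

lemma neg_pow_fps_zero: "neg_pow_fps c 0 = 1"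
  by (rule fps_ext) (simp add: neg_pow_fps_nth pochhammer_0_left)

lemma neg_pow_fps_minus_of_nat:
  "neg_pow_fps c (- of_nat n) = (1 - fps_const c * fps_X) ^ n"
proof (induction n)
  case (Suc n)
  have "neg_pow_fps c (- of_nat (Suc n)) = neg_pow_fps c (- 1 + - of_nat n)"
    by simp
  also have "\<dots> = (1 - fps_const c * fps_X) ^ Suc n"
    unfolding neg_pow_fps_add neg_pow_fps_minus_one Suc by simp
  finally show ?case .
qed (simp add: neg_pow_fps_zero)

lemma neg_pow_fps_deriv:
  "fps_deriv (neg_pow_fps c a) = fps_const (a * c) * neg_pow_fps c (a + 1)"
  by (rule fps_ext) (simp add: neg_pow_fps_nth pochhammer_rec field_simps del: of_nat_Suc)

lemma neg_pow_fps_shift: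
  "(1 - fps_const c * fps_X) * neg_pow_fps c (a + 1) = neg_pow_fps c a"
  using neg_pow_fps_add[of c "-1" "a + 1"] by (simp add: neg_pow_fps_minus_one)

section \<open>The coefficient for b = n + 1\<close>

lemma coeff_base_rec:
  fixes a :: "'a::field_char_0"
  shows "of_nat (n + 1) * (neg_pow_fps 1 (of_nat (n + 1) + 1) * neg_pow_fps 2 a) $ (n + 1)
     = 2 * (a + 1) * (neg_pow_fps 1 (of_nat (n + 1)) * neg_pow_fps 2 (a + 2)) $ n"
proof -
  define m :: 'a where "m = of_nat (n + 1)"
  define P where "P = neg_pow_fps 1 (m + 1)"
  define Q where "Q = neg_pow_fps 2 (a + 1 + 1)"
  define G where "G = neg_pow_fps 1 m * neg_pow_fps 2 (a + 1)"
  have P: "neg_pow_fps 1 m = (1 - fps_X) * P"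
    using neg_pow_fps_shift[of 1 m] by (simp add: P_def)
  have Q: "neg_pow_fps 2 (a + 1) = (1 - fps_const 2 * fps_X) * Q"
    using neg_pow_fps_shift[of 2 "a + 1"] by (simp add: Q_def)
  have Q': "neg_pow_fps 2 a = (1 - fps_const 2 * fps_X) * ((1 - fps_const 2 * fps_X) * Q)"
    using neg_pow_fps_shift[of 2 a] Q by simp
  have D: "fps_deriv G = fps_const m * P * neg_pow_fps 2 (a + 1)
          + neg_pow_fps 1 m * (fps_const ((a + 1) * 2) * Q)"
    by (simp add: G_def P_def Q_def neg_pow_fps_deriv)
  \<comment> \<open>Everything is a multiple of \<open>P * Q\<close>. The two terms with the factor
    \<open>m\<close> combine through x - (1-x) = -(1-2x), which completes the square (1-2x)^2 hidden
    in \<open>neg_pow_fps 2 a\<close>.\<close>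
  have "fps_X * fps_deriv G - fps_const m * G
      = fps_const ((a + 1) * 2) * (fps_X * (neg_pow_fps 1 m * Q)) - fps_const m * (P * neg_pow_fps 2 a)"
    unfolding D unfolding G_def P Q Q' fps_const_mult[symmetric] fps_numeral_fps_const[symmetric]
    by (simp add: algebra_simps)
  then have "(fps_X * fps_deriv G - fps_const m * G) $ (n + 1)
      = (fps_const ((a + 1) * 2) * (fps_X * (neg_pow_fps 1 m * Q)) - fps_const m * (P * neg_pow_fps 2 a)) $ (n + 1)"
    by (rule arg_cong)
  \<comment> \<open>The operator x d/dx multiplies the coefficient at exponent \<open>n + 1\<close>
    by exactly \<open>m\<close>.\<close>
  moreover have "(fps_X * fps_deriv G - fps_const m * G) $ (n + 1) = 0"
    by (simp add: m_def)
  ultimately have "m * (P * neg_pow_fps 2 a) $ (n + 1) = (a + 1) * 2 * (neg_pow_fps 1 m * Q) $ n"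
    by simp
  then show ?thesis
    by (simp add: m_def P_def Q_def mult_ac add_ac)
qed

lemma coeff_base:
  fixes a :: "'a::field_char_0"
  shows "(neg_pow_fps 1 (of_nat n + 1) * neg_pow_fps 2 a) $ n
     = 4 ^ n / fact n * pochhammer (a / 2 + 1 / 2) n"
\<comment> \<open>The recurrence passes from \<open>a\<close> to \<open>a + 2\<close>, so the
  induction hypothesis is needed for every \<open>a\<close>.\<close>
proof (induction n arbitrary: a)
  case (Suc n)
  have half: "(a + 2) / 2 + 1 / 2 = a / 2 + 1 / 2 + 1"
    by (simp add: field_simps)
  have "of_nat (n + 1) * (neg_pow_fps 1 (of_nat (n + 1) + 1) * neg_pow_fps 2 a) $ (n + 1)
      = 2 * (a + 1) * (4 ^ n / fact n * pochhammer (a / 2 + 1 / 2 + 1) n)"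
    unfolding coeff_base_rec half[symmetric] Suc[symmetric] by (simp add: add_ac)
  \<comment> \<open>Since 2(a+1) = 4(a/2 + 1/2), the recurrence supplies both the new factor 4 and
    the first factor of the longer Pochhammer symbol.\<close>
  also have "\<dots> = of_nat (n + 1) * (4 ^ Suc n / fact (Suc n) * pochhammer (a / 2 + 1 / 2) (Suc n))"
    by (simp add: pochhammer_rec field_simps del: of_nat_Suc)
  finally show ?case
    using mult_left_cancel[of "of_nat (n + 1) :: 'a"] by (simp only: Suc_eq_plus1 of_nat_eq_0_iff)
qed (simp add: neg_pow_fps_nth)

section \<open>Shifting b by an integer\<close>

text \<open>The base of the power is 1-x for \<open>s = 1\<close> and x for \<open>s = -1\<close>,
  so one expansion serves both parts of the theorem. Each factor (1-2x)^r only lowers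
  \<open>a\<close> by r.\<close>

lemma fps_nth_mult_power_expand:
  fixes G :: "'a::field_char_0 fps"
  shows "(G * neg_pow_fps 2 a * (fps_const (1 / 2) * (1 + fps_const s * (1 - fps_const 2 * fps_X))) ^ j) $ n
    = (1 / 2) ^ j * (\<Sum>r=0..j. s ^ r * of_nat (j choose r) * (G * neg_pow_fps 2 (a - of_nat r)) $ n)"
proof -
  have "(1 + fps_const s * (1 - fps_const 2 * fps_X)) ^ j
      = (\<Sum>r=0..j. fps_const (s ^ r * of_nat (j choose r)) * neg_pow_fps 2 (- of_nat r))"
    using binomial_ring[of "fps_const s * (1 - fps_const 2 * fps_X)" 1 j]
    by (simp add: neg_pow_fps_minus_of_nat power_mult_distrib fps_const_power atLeast0AtMost
        add.commute mult_ac fps_of_nat flip: fps_const_mult)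
  then have "G * neg_pow_fps 2 a * (fps_const (1 / 2) * (1 + fps_const s * (1 - fps_const 2 * fps_X))) ^ j
      = fps_const ((1 / 2) ^ j) * (\<Sum>r=0..j. fps_const (s ^ r * of_nat (j choose r)) *
          (G * (neg_pow_fps 2 a * neg_pow_fps 2 (- of_nat r))))"
    by (simp add: power_mult_distrib fps_const_power sum_distrib_left sum_distrib_right mult_ac)
  then show ?thesis
    by (simp add: fps_sum_nth mult.assoc flip: neg_pow_fps_add)
qed

text \<open>Here \<open>j\<close> is arbitrary: the gap from n+1 to 2n arises only later, on
  division by (b)_n.\<close>

lemma coeff_upper:
  fixes a :: "'a::field_char_0"
  shows "(neg_pow_fps 1 (of_nat n + 1 - of_nat j) * neg_pow_fps 2 a) $ n
    = 4 ^ n / 2 ^ j / fact n *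
        (\<Sum>r=0..j. of_nat (j choose r) * pochhammer (a / 2 + 1 / 2 - of_nat r / 2) n)"
proof -
  have x: "1 - fps_X = fps_const (1 / 2) * (1 + fps_const 1 * (1 - fps_const (2::'a) * fps_X))"
    by (rule fps_ext) (simp add: fps_X_def fps_numeral_nth field_simps)
  have "neg_pow_fps (1::'a) (of_nat n + 1 - of_nat j) = neg_pow_fps 1 (of_nat n + 1) * (1 - fps_X) ^ j"
    using neg_pow_fps_add[of "1::'a" "of_nat n + 1" "- of_nat j"] by (simp add: neg_pow_fps_minus_of_nat)
  then have "(neg_pow_fps 1 (of_nat n + 1 - of_nat j) * neg_pow_fps 2 a) $ n
      = (neg_pow_fps 1 (of_nat n + 1) * neg_pow_fps 2 a * (1 - fps_X) ^ j) $ n"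
    by (simp only: mult_ac)
  also have "\<dots> = (neg_pow_fps 1 (of_nat n + 1) * neg_pow_fps 2 a *
      (fps_const (1 / 2) * (1 + fps_const 1 * (1 - fps_const 2 * fps_X))) ^ j) $ n"
    by (simp only: x)
  finally show ?thesis
    unfolding fps_nth_mult_power_expand coeff_base
    by (simp add: sum_distrib_left diff_divide_distrib power_divide mult_ac add_ac algebra_simps)
qed

lemma coeff_lower:
  fixes a :: "'a::field_char_0"
  shows "(neg_pow_fps 1 (of_nat n + 1 + of_nat j) * neg_pow_fps 2 a) $ n
    = 4 ^ (n + j) / 2 ^ j / fact (n + j) *
        (\<Sum>r=0..j. (-1) ^ r * of_nat (j choose r) * pochhammer (a / 2 + 1 / 2 - of_nat r / 2) (n + j))"
proof -
  let ?F = "neg_pow_fps 1 (of_nat (n + j) + 1) * neg_pow_fps 2 a"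
  have x: "fps_X = fps_const (1 / 2) * (1 + fps_const (- 1) * (1 - fps_const (2::'a) * fps_X))"
    by (rule fps_ext) (simp add: fps_X_def fps_numeral_nth field_simps)
  \<comment> \<open>The shift by \<open>j\<close> makes index and exponent match:
    \<open>coeff_base\<close> applies with \<open>n + j\<close> for \<open>n\<close>.\<close>
  have "(neg_pow_fps 1 (of_nat n + 1 + of_nat j) * neg_pow_fps 2 a) $ n = (?F * fps_X ^ j) $ (n + j)"
    by (simp add: fps_X_power_mult_right_nth add_ac)
  also have "\<dots> = (?F * (fps_const (1 / 2) * (1 + fps_const (- 1) * (1 - fps_const 2 * fps_X))) ^ j) $ (n + j)"
    using x by simp
  finally show ?thesis
    unfolding fps_nth_mult_power_expand coeff_base
    by (simp add: sum_distrib_left diff_divide_distrib power_divide mult_ac add_ac algebra_simps)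
qed

section \<open>The hypergeometric series as a coefficient\<close>

text \<open>Up to sign, the factors of (1-b-n)_k are the last k factors of (b)_n in reverse
  order.\<close>

lemma pochhammer_reflect:
  fixes b :: "'a::comm_ring_1"
  assumes "k \<le> n"
  shows "pochhammer b (n - k) * pochhammer (1 - b - of_nat n) k = (-1) ^ k * pochhammer b n"
proof -
  have "pochhammer (1 - b - of_nat n) k = (-1) ^ k * pochhammer (b + of_nat (n - k)) k"
    using pochhammer_minus[of "b + of_nat n - 1" k] assms by (simp add: of_nat_diff algebra_simps)
  moreover have "pochhammer b n = pochhammer b (n - k) * pochhammer (b + of_nat (n - k)) k"
    using pochhammer_product[of "n - k" n b] assms by simp
  ultimately show ?thesis
    by (simp add: mult_ac)
qed

text \<open>The summands match those of the Cauchy product one by one, once both (-n)_k and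
  (1-b-n)_k are reflected.\<close>

lemma hyp2F1_term_eq_coeff:
  assumes "pochhammer b n \<noteq> 0"
  shows "hyp2F1_term n a (1 - b - of_nat n) 2
    = fact n / pochhammer b n * (neg_pow_fps 1 b * neg_pow_fps 2 a) $ n"
proof -
  have "pochhammer (- of_nat n) k * pochhammer a k / pochhammer (1 - b - of_nat n) k * (2 ^ k / fact k)
      = fact n / pochhammer b n *
        ((pochhammer b (n - k) / fact (n - k)) * (pochhammer a k / fact k * 2 ^ k))"
    if "k \<le> n" for k
  proof -
    have b: "pochhammer b (n - k) * pochhammer (1 - b - of_nat n) k = (-1) ^ k * pochhammer b n"
      using pochhammer_reflect[OF that] .
    \<comment> \<open>Hence no summand hides a division by zero.\<close>
    with assms have c: "pochhammer (1 - b - of_nat n) k \<noteq> 0"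
      by auto
    \<comment> \<open>Reflection at b = 1, where (1)_m = m! and 1-b-n = -n.\<close>
    have "fact (n - k) * pochhammer (- of_nat n :: complex) k = (-1) ^ k * fact n"
      using pochhammer_reflect[OF that, of "1::complex"] by (simp add: pochhammer_fact)
    then have d: "pochhammer (- of_nat n :: complex) k = (-1) ^ k * fact n / fact (n - k)"
      by (simp add: field_simps)
    have "(-1) ^ k / pochhammer (1 - b - of_nat n) k = pochhammer b (n - k) / pochhammer b n"
      using b c assms by (simp add: field_simps flip: power_add)
    then have "(-1) ^ k / pochhammer (1 - b - of_nat n) k *
         (fact n / fact (n - k) * pochhammer a k * (2 ^ k / fact k))
      = pochhammer b (n - k) / pochhammer b n *
         (fact n / fact (n - k) * pochhammer a k * (2 ^ k / fact k))"
      by simp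
    then show ?thesis
      unfolding d by (simp add: mult_ac)
  qed
  then have "hyp2F1_term n a (1 - b - of_nat n) 2 = fact n / pochhammer b n *
      (\<Sum>k=0..n. (pochhammer a k / fact k * 2 ^ k) * (pochhammer b (n - k) / fact (n - k)))"
    by (simp add: hyp2F1_term_def sum_distrib_left mult_ac)
  also have "(\<Sum>k=0..n. (pochhammer a k / fact k * 2 ^ k) * (pochhammer b (n - k) / fact (n - k)))
      = (neg_pow_fps 2 a * neg_pow_fps 1 b) $ n"
    by (simp add: fps_mult_nth neg_pow_fps_nth)
  finally show ?thesis
    by (simp add: mult.commute)
qed

lemma pochhammer_Suc_of_nat:
  "pochhammer (of_nat m + 1) n = (fact (m + n) / fact m :: 'a::field_char_0)"
  using pochhammer_product'[of "1::'a" m n] by (simp add: pochhammer_fact[symmetric] add_ac field_simps)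

theorem theorem2:
  fixes n :: nat and a :: complex
  assumes "n \<ge> 1"
  shows "(\<forall>j::nat. j \<notin> {n+1..2*n} \<longrightarrow>
            hyp2F1_term n a (- 2 * of_nat n + of_nat j) 2 =
              2 powi (2 * int n - int j) *
              (if j \<ge> 2*n+1
               then (-1) ^ n * fact (j - 2*n - 1) / fact (j - n - 1)
               else fact (n - j) / fact (2*n - j)) *
              (\<Sum>r=0..j. of_nat (j choose r) * pochhammer (a/2 + 1/2 - of_nat r / 2) n)) \<and>
         (\<forall>j::nat.
            hyp2F1_term n a (- 2 * of_nat n - of_nat j) 2 =
              2 ^ (2*n + j) * fact n / fact (2*n + j) *
              (\<Sum>r=0..j. (-1) ^ r * of_nat (j choose r) *
                  pochhammer (a/2 + 1/2 - of_nat r / 2) (n + j)))"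
proof (intro conjI allI impI)
  fix j :: nat
  assume j: "j \<notin> {n+1..2*n}"
  define b :: complex where "b = of_nat n + 1 - of_nat j"
  define R :: complex where "R = (if j \<ge> 2*n+1
               then (-1) ^ n * fact (j - 2*n - 1) / fact (j - n - 1)
               else fact (n - j) / fact (2*n - j))"
  \<comment> \<open>Outside the gap, \<open>b\<close> is either a positive integer or at most -n, so
    (b)_n does not vanish.\<close>
  have "pochhammer b n = 1 / R"
  proof (cases "j \<ge> 2*n+1")
    case True
    then have "b = - of_nat (j - n - 1)"
      by (simp add: b_def of_nat_diff)
    \<comment> \<open>All n factors are negative integers or zero-free by the bound on
      \<open>j\<close>; reversing them with the sign pulled out leaves a quotient of
      factorials.\<close>
    then have "pochhammer b n = (-1) ^ n * pochhammer (of_nat (j - n - 1) - of_nat n + 1) n"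
      by (simp only: pochhammer_minus)
    also have "of_nat (j - n - 1) - of_nat n = (of_nat (j - 2*n - 1) :: complex)"
      using True by (simp add: of_nat_diff)
    also have "pochhammer (of_nat (j - 2*n - 1) + 1) n = (fact (j - n - 1) / fact (j - 2*n - 1) :: complex)"
      unfolding pochhammer_Suc_of_nat using True by (simp add: mult_2)
    finally show ?thesis
      using True by (cases "even n") (simp_all add: R_def)
  next
    case False
    with j have "j \<le> n" by auto
    then have "b = of_nat (n - j) + 1" "n - j + n = 2 * n - j"
      by (auto simp: b_def of_nat_diff)
    then show ?thesis
      using False by (simp only: pochhammer_Suc_of_nat) (simp add: R_def)
  qed
  moreover have "R \<noteq> 0"
    by (simp add: R_def)
  moreover have "- 2 * of_nat n + of_nat j = 1 - b - of_nat n"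
    by (simp add: b_def)
  moreover have "(2::complex) powi (2 * int n - int j) = 4 ^ n / 2 ^ j"
    by (simp add: power_int_diff power_int_mult)
  ultimately show "hyp2F1_term n a (- 2 * of_nat n + of_nat j) 2 = 2 powi (2 * int n - int j) *
      R * (\<Sum>r=0..j. of_nat (j choose r) * pochhammer (a/2 + 1/2 - of_nat r / 2) n)"
    using hyp2F1_term_eq_coeff[of b n a] coeff_upper[of n j a]
    by (simp add: b_def)
next
  fix j :: nat
  define b :: complex where "b = of_nat n + 1 + of_nat j"
  have "b = of_nat (n + j) + 1"
    by (simp add: b_def)
  \<comment> \<open>The denominator \<open>fact (n + j)\<close> will cancel the one in
    \<open>coeff_lower\<close>.\<close>
  then have "pochhammer b n = fact (2 * n + j) / fact (n + j)"
    by (simp only: pochhammer_Suc_of_nat) (simp add: mult_2 add_ac)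
  moreover have "- 2 * of_nat n - of_nat j = 1 - b - of_nat n"
    by (simp add: b_def)
  moreover have "(4::complex) ^ (n + j) / 2 ^ j = 2 ^ (2 * n + j)"
    using power_mult_distrib[of "2::complex" 2 j] by (simp add: power_add power_mult)
  ultimately show "hyp2F1_term n a (- 2 * of_nat n - of_nat j) 2 =
      2 ^ (2*n + j) * fact n / fact (2*n + j) *
      (\<Sum>r=0..j. (-1) ^ r * of_nat (j choose r) * pochhammer (a/2 + 1/2 - of_nat r / 2) (n + j))"
    using hyp2F1_term_eq_coeff[of b n a] coeff_lower[of n j a]
    by (simp add: b_def)
qed

end
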